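(* Let $\Sigma$ be a finite alphabet and consider the trace transition system $LTS_{\mathrm{tr}}$ over $\Sigma$, whose processes are the infinite words in $\Sigma^\omega$. Then $$\left\langle \{O(s)\mid s\in\Sigma^*\}\right\rangle=\tau(\sqsubseteq_{T}^{\mathrm{fin}})=\tau_{\mathrm{Cantor}} .$$ Moreover, $\tau(\sqsubseteq_{T})=\mathcal P(\Sigma^\omega)$ (the discrete topology). Hence, if $|\Sigma|\ge 2$, then $$\left\langle \{O(s)\mid s\in\Sigma^*\}\right\rangle=\tau(\sqsubseteq_{T}^{\mathrm{fin}})\subsetneq\tau(\sqsubseteq_{T}).$$
   Context: $\Sigma^*$ and $\Sigma^\omega$ are the sets of finite and of infinite words over $\Sigma$; $s\preceq t$ means that $s$ is a finite prefix of $t$. For a family $\mathcal F$ of subsets of a set $X$, $\langle\mathcal F\rangle$ is the smallest topology on $X$ containing $\mathcal F$. A labelled transition system (LTS) is $\langle \mathrm{Proc},\Sigma,\to\rangle$ with $\to\subseteq \mathrm{Proc}\times\Sigma\times\mathrm{Proc}$. For a process $p$, $\mathrm{Trc}(p)\subseteq\Sigma^*\cup\Sigma^\omega$ is the set of finite words $a_1\cdots a_n$ for which there are $p=p_0\xrightarrow{a_1}p_1\cdots\xrightarrow{a_n}p_n$ (the empty word $\varepsilon$ always belongs), together with the infinite words $a_1a_2\cdots$ for which there is an infinite sequence $p=p_0\xrightarrow{a_1}p_1\xrightarrow{a_2}\cdots$. The trace transition system is $LTS_{\mathrm{tr}}=\langle\Sigma^\omega,\Sigma,\to\rangle$ with $t_1\xrightarrow{a}t_2$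 iff $t_1=a\cdot t_2$. For $s\in\Sigma^*$, $O(s)=\{t\in\Sigma^\omega\mid s\in\mathrm{Trc}(t)\}$. The Cantor topology is $\tau_{\mathrm{Cantor}}=\langle\{s\cdot\Sigma^\omega\mid s\in\Sigma^*\}\rangle$, where $s\cdot\Sigma^\omega=\{t\in\Sigma^\omega\mid s\preceq t\}$. For a preorder $\sqsubseteq$ on a set $X$, $\tau(\sqsubseteq)$ is the Alexandroff topology, consisting of all subsets of $X$ that are upward-closed with respect to $\sqsubseteq$. The full trace preorder is $p\sqsubseteq_T q\iff \mathrm{Trc}(p)\subseteq\mathrm{Trc}(q)$. For $k\in\mathbb N$, $\mathrm{Trc}_k(p)=\mathrm{Trc}(p)\cap\Sigma^k$ and $p\sqsubseteq_T^k q\iff\mathrm{Trc}_k(p)\subseteq\mathrm{Trc}_k(q)$. Finally, $\tau(\sqsubseteq_T^{\mathrm{fin}})=\left\langle\bigcup_{k\ge0}\tau(\sqsubseteq_T^k)\right\rangle$. All of these are taken here on $\Sigma^\omega$ as the process set of $LTS_{\mathrm{tr}}$. *)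

theory Defs
  imports "HOL-Analysis.Analysis" "HOL-Library.Stream"
begin

section \<open>Topologies\<close>

text \<open>
  The smallest topology on \<open>X\<close> containing \<open>F\<close>, for \<open>F \<subseteq> Pow X\<close>. The library's
  \<^const>\<open>topology_generated_by\<close> has the underlying set \<open>\<Union>F\<close>; inserting \<open>X\<close> makes
  the underlying set \<open>X\<close> even when \<open>F\<close> does not cover it.
\<close>
definition generated_topology :: "'x set \<Rightarrow> 'x set set \<Rightarrow> 'x topology" where
  "generated_topology X F = topology_generated_by (insert X F)"

definition alexandroff_topology :: "'x set \<Rightarrow> ('x \<Rightarrow> 'x \<Rightarrow> bool) \<Rightarrow> 'x topology" where
  "alexandroff_topology X le =
     topology (\<lambda>U. U \<subseteq> X \<and> (\<forall>x\<in>U. \<forall>y\<in>X. le x y \<longrightarrow> y \<in> U))"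

lemma openin_alexandroff_topology:
  "openin (alexandroff_topology X le) U \<longleftrightarrow>
     U \<subseteq> X \<and> (\<forall>x\<in>U. \<forall>y\<in>X. le x y \<longrightarrow> y \<in> U)"
proof -
  have "istopology (\<lambda>U. U \<subseteq> X \<and> (\<forall>x\<in>U. \<forall>y\<in>X. le x y \<longrightarrow> y \<in> U))"
    unfolding istopology_def by blast
  then show ?thesis
    by (simp add: alexandroff_topology_def topology_inverse')
qed


section \<open>Labelled transition systems and traces\<close>

record ('p, 'a) lts =
  procs :: "'p set"
  labels :: "'a set"
  steps :: "('p \<times> 'a \<times> 'p) set"

definition wf_lts :: "('p, 'a) lts \<Rightarrow> bool" where
  "wf_lts L \<longleftrightarrow> steps L \<subseteq> procs L \<times> labels L \<times> procs L"

datatype 'a trace = Fin "'a list" | Inf "'a stream"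

text \<open>
  In both clauses the run \<open>p\<^sub>0, p\<^sub>1, \<dots>\<close> is the function \<open>r\<close>; for a finite word \<open>w\<close> its
  values beyond \<open>length w\<close> are irrelevant.
\<close>
definition Trc :: "('p, 'a) lts \<Rightarrow> 'p \<Rightarrow> 'a trace set" where
  "Trc L p =
     {Fin w |w. \<exists>r. r 0 = p \<and> (\<forall>i<length w. (r i, w ! i, r (Suc i)) \<in> steps L)} \<union>
     {Inf w |w. \<exists>r. r 0 = p \<and> (\<forall>i. (r i, w !! i, r (Suc i)) \<in> steps L)}"

definition Trc_k :: "('p, 'a) lts \<Rightarrow> nat \<Rightarrow> 'p \<Rightarrow> 'a trace set" where
  "Trc_k L k p = Trc L p \<inter> {Fin w |w. w \<in> lists (labels L) \<and> length w = k}"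

definition trace_le :: "('p, 'a) lts \<Rightarrow> 'p \<Rightarrow> 'p \<Rightarrow> bool" where
  "trace_le L p q \<longleftrightarrow> Trc L p \<subseteq> Trc L q"

definition trace_le_k :: "('p, 'a) lts \<Rightarrow> nat \<Rightarrow> 'p \<Rightarrow> 'p \<Rightarrow> bool" where
  "trace_le_k L k p q \<longleftrightarrow> Trc_k L k p \<subseteq> Trc_k L k q"

definition trace_topology :: "('p, 'a) lts \<Rightarrow> 'p topology" where
  "trace_topology L = alexandroff_topology (procs L) (trace_le L)"

definition fin_trace_topology :: "('p, 'a) lts \<Rightarrow> 'p topology" where
  "fin_trace_topology L =
     generated_topology (procs L)
       (\<Union>k. {U. openin (alexandroff_topology (procs L) (trace_le_k L k)) U})"

text \<open>The set \<open>O(s)\<close> of processes having the finite trace \<open>s\<close>.\<close>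
definition obs :: "('p, 'a) lts \<Rightarrow> 'a list \<Rightarrow> 'p set" where
  "obs L s = {p \<in> procs L. Fin s \<in> Trc L p}"

definition obs_topology :: "('p, 'a) lts \<Rightarrow> 'p topology" where
  "obs_topology L = generated_topology (procs L) {obs L s |s. s \<in> lists (labels L)}"


section \<open>Infinite words\<close>

text \<open>
  The alphabet is a set \<open>\<Sigma>\<close>, so that \<open>\<Sigma>\<^sup>*\<close> is \<^term>\<open>lists \<Sigma>\<close> and the set of infinite
  words over \<open>\<Sigma>\<close> is \<^term>\<open>streams \<Sigma>\<close>.
\<close>
definition trace_lts :: "'a set \<Rightarrow> ('a stream, 'a) lts" where
  "trace_lts \<Sigma> =
     \<lparr> procs = streams \<Sigma>,
       labels = \<Sigma>,
       steps = {(t1, a, t2). t1 \<in> streams \<Sigma> \<and> a \<in> \<Sigma> \<and> t2 \<in> streams \<Sigma> \<and> t1 = a ## t2} \<rparr>"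

lemma wf_trace_lts: "wf_lts (trace_lts \<Sigma>)"
  by (auto simp: wf_lts_def trace_lts_def)

definition finite_prefix :: "'a list \<Rightarrow> 'a stream \<Rightarrow> bool" where
  "finite_prefix s t \<longleftrightarrow> (\<exists>u. t = s @- u)"

definition cantor_topology :: "'a set \<Rightarrow> 'a stream topology" where
  "cantor_topology \<Sigma> =
     generated_topology (streams \<Sigma>) {{t \<in> streams \<Sigma>. finite_prefix s t} |s. s \<in> lists \<Sigma>}"

end

theory Submission
  imports Defs
begin

text \<open>
  A trace \<open>t\<close> has exactly one maximal run, through its own suffixes. Hence \<open>O(s)\<close> is the
  cylinder of \<open>s\<close>, the preorder of depth \<open>k\<close> is equality of prefixes of length \<open>k\<close>, and the
  full trace preorder is equality. The sets that are saturated for equality of prefixes of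
  length \<open>k\<close> are the unions of cylinders of words of length \<open>k\<close>, so they generate the Cantor
  topology. If the alphabet has two letters, a constant word is not isolated in the latter.
\<close>

text \<open>A word over \<open>\<Sigma>\<close> has its head in \<open>\<Sigma>\<close> and its tail
  over \<open>\<Sigma>\<close>, so the other membership conditions of a step follow from that of its
  source. In this form both the label and the target are functions of the source.\<close>

lemma steps_trace_lts_iff:
  "(t, a, u) \<in> steps (trace_lts \<Sigma>) \<longleftrightarrow> t \<in> streams \<Sigma> \<and> shd t = a \<and> stl t = u"
  by (cases t) (auto simp: trace_lts_def streams_Stream)

lemma procs_trace_lts [simp]: "procs (trace_lts \<Sigma>) = streams \<Sigma>"
  and labels_trace_lts [simp]: "labels (trace_lts \<Sigma>) = \<Sigma>"
  by (simp_all add: trace_lts_def)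

text \<open>Each step can only remove the head, so a run is forced by its start. The labels
  \<open>f\<close> and the bound \<open>n\<close> are left general so that the lemma serves runs of
  finite words and initial parts of infinite runs alike.\<close>

lemma run_trace_lts_eq_sdrop:
  assumes "r 0 = t" "\<forall>i<n. (r i, f i, r (Suc i)) \<in> steps (trace_lts \<Sigma>)" "i \<le> n"
  shows "r i = sdrop i t"
  using assms(3)
proof (induction i)
  case (Suc i)
  have "(r i, f i, r (Suc i)) \<in> steps (trace_lts \<Sigma>)" using assms(2) Suc.prems by simp
  with Suc show ?case by (simp add: steps_trace_lts_iff)
qed (simp add: assms(1))

lemma stake_in_lists: "t \<in> streams \<Sigma> \<Longrightarrow> stake k t \<in> lists \<Sigma>"
  by (induction k arbitrary: t) (auto simp: streams_shd streams_stl)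

lemma sdrop_in_streams: "t \<in> streams \<Sigma> \<Longrightarrow> sdrop k t \<in> streams \<Sigma>"
  by (simp add: streams_iff_snth sdrop_snth)

lemma Fin_in_Trc_trace_lts_iff:
  assumes "t \<in> streams \<Sigma>"
  shows "Fin w \<in> Trc (trace_lts \<Sigma>) t \<longleftrightarrow> stake (length w) t = w"
proof
  assume "Fin w \<in> Trc (trace_lts \<Sigma>) t"
  then obtain r where r: "r 0 = t"
    "\<forall>i<length w. (r i, w ! i, r (Suc i)) \<in> steps (trace_lts \<Sigma>)"
    by (auto simp: Trc_def)
  have "t !! i = w ! i" if "i < length w" for i
  proof -
    \<comment> \<open>The label of step \<open>i\<close> is the head of \<open>r i\<close>, hence
      the letter of \<open>t\<close> at position \<open>i\<close>.\<close>
    have "r i = sdrop i t"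
      by (rule run_trace_lts_eq_sdrop[where f = "(!) w" and n = "length w"])
        (use r that in auto)
    with r(2) that show ?thesis by (auto simp: steps_trace_lts_iff)
  qed
  then show "stake (length w) t = w" by (simp add: list_eq_iff_nth_eq)
next
  assume "stake (length w) t = w"
  then have "t !! i = w ! i" if "i < length w" for i using that by (metis stake_nth)
  then have "\<forall>i<length w. (sdrop i t, w ! i, sdrop (Suc i) t) \<in> steps (trace_lts \<Sigma>)"
    using assms by (simp add: steps_trace_lts_iff sdrop_in_streams)
  then show "Fin w \<in> Trc (trace_lts \<Sigma>) t"
    unfolding Trc_def by (auto intro!: exI[of _ "\<lambda>i. sdrop i t"])
qed

lemma Inf_in_Trc_trace_lts_iff:
  assumes "t \<in> streams \<Sigma>"
  shows "Inf w \<in> Trc (trace_lts \<Sigma>) t \<longleftrightarrow> w = t"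
proof
  assume "Inf w \<in> Trc (trace_lts \<Sigma>) t"
  then obtain r where r: "r 0 = t" "\<forall>i. (r i, w !! i, r (Suc i)) \<in> steps (trace_lts \<Sigma>)"
    by (auto simp: Trc_def)
  have "w !! i = t !! i" for i
  proof -
    have "r i = sdrop i t"
      by (rule run_trace_lts_eq_sdrop[where \<Sigma> = \<Sigma> and f = "(!!) w" and n = i])
        (use r in blast)+
    moreover have "shd (r i) = w !! i" using r(2) by (simp only: steps_trace_lts_iff)
    ultimately show ?thesis by simp
  qed
  \<comment> \<open>With \<open>id\<close> as the mapped function, \<open>smap_alt\<close> becomes
    extensionality of streams.\<close>
  then show "w = t" using smap_alt[of id w t] by (simp add: stream.map_id)
next
  assume "w = t"
  moreover have "\<forall>i. (sdrop i t, t !! i, sdrop (Suc i) t) \<in> steps (trace_lts \<Sigma>)"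
    using assms by (simp add: steps_trace_lts_iff sdrop_in_streams)
  ultimately show "Inf w \<in> Trc (trace_lts \<Sigma>) t"
    unfolding Trc_def by (auto intro!: exI[of _ "\<lambda>i. sdrop i t"])
qed

lemma finite_prefix_iff_stake: "finite_prefix s t \<longleftrightarrow> stake (length s) t = s"
proof
  assume "stake (length s) t = s"
  then have "t = s @- sdrop (length s) t" using stake_sdrop[of "length s" t] by simp
  then show "finite_prefix s t" unfolding finite_prefix_def ..
qed (auto simp: finite_prefix_def stake_shift)

text \<open>\<open>Trc_k\<close> is a singleton on infinite words, and inclusion between singletons
  is equality. So this preorder is an equivalence.\<close>

lemma trace_le_k_trace_lts_iff:
  assumes "t \<in> streams \<Sigma>" "u \<in> streams \<Sigma>"
  shows "trace_le_k (trace_lts \<Sigma>) k t u \<longleftrightarrow> stake k t = stake k u"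
proof -
  have "Trc_k (trace_lts \<Sigma>) k x = {Fin (stake k x)}" if "x \<in> streams \<Sigma>" for x
    using that stake_in_lists[OF that]
    by (auto simp: Trc_k_def Fin_in_Trc_trace_lts_iff)
  with assms show ?thesis by (auto simp: trace_le_k_def)
qed

text \<open>The infinite traces decide: \<open>t\<close> has itself as an infinite trace, and
  \<open>u\<close> has no infinite trace but \<open>u\<close>.\<close>

lemma trace_le_trace_lts_iff:
  assumes "t \<in> streams \<Sigma>" "u \<in> streams \<Sigma>"
  shows "trace_le (trace_lts \<Sigma>) t u \<longleftrightarrow> t = u"
proof
  assume "trace_le (trace_lts \<Sigma>) t u"
  moreover have "Inf t \<in> Trc (trace_lts \<Sigma>) t" using assms(1) by (simp add: Inf_in_Trc_trace_lts_iff)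
  ultimately have "Inf t \<in> Trc (trace_lts \<Sigma>) u" unfolding trace_le_def by blast
  with assms(2) show "t = u" by (simp add: Inf_in_Trc_trace_lts_iff)
qed (simp add: trace_le_def)

lemma obs_topology_trace_lts: "obs_topology (trace_lts \<Sigma>) = cantor_topology \<Sigma>"
proof -
  have "obs (trace_lts \<Sigma>) s = {t \<in> streams \<Sigma>. finite_prefix s t}" for s
    by (auto simp: obs_def Fin_in_Trc_trace_lts_iff finite_prefix_iff_stake)
  then show ?thesis by (simp add: obs_topology_def cantor_topology_def)
qed

lemma trace_topology_trace_lts:
  "trace_topology (trace_lts \<Sigma>) = discrete_topology (streams \<Sigma>)"
  by (auto simp: topology_eq trace_topology_def openin_alexandroff_topology
      trace_le_trace_lts_iff subset_iff)

lemma openin_generated_topologyI: "U \<in> insert X F \<Longrightarrow> openin (generated_topology X F) U"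
  unfolding generated_topology_def by (rule topology_generated_by_Basis)

text \<open>Minimality of the generated topology. Openness of \<open>X\<close> in \<open>T\<close>
  is asked for because \<open>X\<close> is inserted among the generators.\<close>

lemma openin_generated_topology_mono:
  assumes "openin (generated_topology X F) U" "openin T X" "\<And>V. V \<in> F \<Longrightarrow> openin T V"
  shows "openin T U"
proof -
  have "generate_topology_on (insert X F) U"
    using assms(1) by (simp add: generated_topology_def openin_topology_generated_by_iff)
  then show ?thesis
  proof (induction rule: generate_topology_on.induct)
    case (Basis V)
    with assms(2,3) show ?case by blast
  qed (auto intro: openin_Int openin_Union)
qed

text \<open>The cylinders of the prefixes of \<open>t\<close> form a neighbourhood base at
  \<open>t\<close>. From left to right, the condition \<open>?P\<close> itself defines a topology
  that contains the generators, so minimality applies. From right to left, \<open>U\<close> contains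
  a cylinder around each of its points.\<close>

lemma openin_cantor_topology_iff:
  "openin (cantor_topology \<Sigma>) U \<longleftrightarrow>
     U \<subseteq> streams \<Sigma> \<and> (\<forall>t\<in>U. \<exists>k. \<forall>u\<in>streams \<Sigma>. stake k u = stake k t \<longrightarrow> u \<in> U)"
  (is "_ \<longleftrightarrow> ?P U")
proof
  have "istopology ?P"
    unfolding istopology_def
  proof (intro conjI allI impI)
    fix S T assume ST: "?P S" "?P T"
    show "S \<inter> T \<subseteq> streams \<Sigma>" using ST by blast
    show "\<forall>t\<in>S \<inter> T. \<exists>k. \<forall>u\<in>streams \<Sigma>. stake k u = stake k t \<longrightarrow> u \<in> S \<inter> T"
    proof
      fix t assume "t \<in> S \<inter> T"
      with ST obtain k l where
        k: "\<forall>u\<in>streams \<Sigma>. stake k u = stake k t \<longrightarrow> u \<in> S" and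
        l: "\<forall>u\<in>streams \<Sigma>. stake l u = stake l t \<longrightarrow> u \<in> T" by blast
      \<comment> \<open>Agreement up to the larger depth implies agreement up to both: truncate the
        longer prefixes with \<open>take\<close>.\<close>
      have "stake k u = stake k t \<and> stake l u = stake l t"
        if "stake (max k l) u = stake (max k l) t" for u
        using arg_cong[OF that, of "take k"] arg_cong[OF that, of "take l"] by (simp add: take_stake)
      with k l show "\<exists>k. \<forall>u\<in>streams \<Sigma>. stake k u = stake k t \<longrightarrow> u \<in> S \<inter> T" by blast
    qed
  next
    fix K assume K: "\<forall>S\<in>K. ?P S"
    then show "\<Union>K \<subseteq> streams \<Sigma>" by blast
    show "\<forall>t\<in>\<Union>K. \<exists>k. \<forall>u\<in>streams \<Sigma>. stake k u = stake k t \<longrightarrow> u \<in> \<Union>K"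
    proof
      fix t assume "t \<in> \<Union>K"
      then obtain S where S: "S \<in> K" "t \<in> S" ..
      with K obtain k where "\<forall>u\<in>streams \<Sigma>. stake k u = stake k t \<longrightarrow> u \<in> S" by blast
      with S(1) show "\<exists>k. \<forall>u\<in>streams \<Sigma>. stake k u = stake k t \<longrightarrow> u \<in> \<Union>K" by blast
    qed
  qed
  then have P: "openin (topology ?P) V \<longleftrightarrow> ?P V" for V by (simp only: topology_inverse')
  assume "openin (cantor_topology \<Sigma>) U"
  then have "openin (topology ?P) U" unfolding cantor_topology_def
    \<comment> \<open>For the cylinder of \<open>s\<close>, the depth \<open>length s\<close> works
      at every point.\<close>
    by (rule openin_generated_topology_mono) (auto simp: P finite_prefix_iff_stake, metis)
  then show "?P U" by (rule P[THEN iffD1])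
next
  assume U: "?P U"
  have "\<exists>V. openin (cantor_topology \<Sigma>) V \<and> t \<in> V \<and> V \<subseteq> U" if t: "t \<in> U" for t
  proof -
    obtain k where k: "\<forall>u\<in>streams \<Sigma>. stake k u = stake k t \<longrightarrow> u \<in> U" using U t by blast
    have "t \<in> streams \<Sigma>" using U t by blast
    let ?V = "{u \<in> streams \<Sigma>. finite_prefix (stake k t) u}"
    have "openin (cantor_topology \<Sigma>) ?V" unfolding cantor_topology_def
    proof (rule openin_generated_topologyI)
      from \<open>t \<in> streams \<Sigma>\<close> have "stake k t \<in> lists \<Sigma>" by (rule stake_in_lists)
      then show "?V \<in> insert (streams \<Sigma>) {{t \<in> streams \<Sigma>. finite_prefix s t} |s. s \<in> lists \<Sigma>}"
        by blast
    qed
    moreover have "t \<in> ?V" "?V \<subseteq> U"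
      using \<open>t \<in> streams \<Sigma>\<close> k by (simp_all add: finite_prefix_iff_stake subset_iff)
    ultimately show ?thesis by blast
  qed
  then show "openin (cantor_topology \<Sigma>) U" by (subst openin_subopen) blast
qed

text \<open>Minimality is applied in both directions, so only generators have to be compared. For
  sets closed under one of the preorders the depth is uniform, whereas in a Cantor-open set it may
  vary with the point.\<close>

lemma fin_trace_topology_trace_lts: "fin_trace_topology (trace_lts \<Sigma>) = cantor_topology \<Sigma>"
proof -
  have le_k: "openin (alexandroff_topology (streams \<Sigma>) (trace_le_k (trace_lts \<Sigma>) k)) U \<longleftrightarrow>
      U \<subseteq> streams \<Sigma> \<and> (\<forall>t\<in>U. \<forall>u\<in>streams \<Sigma>. stake k t = stake k u \<longrightarrow> u \<in> U)" for k U
    by (auto simp: openin_alexandroff_topology trace_le_k_trace_lts_iff subset_iff)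
  have "openin (cantor_topology \<Sigma>) U" if "openin (fin_trace_topology (trace_lts \<Sigma>)) U" for U
    using that unfolding fin_trace_topology_def procs_trace_lts
  proof (rule openin_generated_topology_mono)
    fix V
    assume "V \<in> (\<Union>k. {U. openin (alexandroff_topology (streams \<Sigma>)
                                  (trace_le_k (trace_lts \<Sigma>) k)) U})"
    then show "openin (cantor_topology \<Sigma>) V"
      \<comment> \<open>The index \<open>k\<close> of the preorder is the depth required at every
        point of \<open>V\<close>.\<close>
      unfolding openin_cantor_topology_iff UN_iff mem_Collect_eq le_k by metis
  qed (simp add: openin_cantor_topology_iff)
  moreover have "openin (fin_trace_topology (trace_lts \<Sigma>)) U"
    if "openin (cantor_topology \<Sigma>) U" for U
    using that unfolding cantor_topology_def
  proof (rule openin_generated_topology_mono)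
    fix V assume "V \<in> {{t \<in> streams \<Sigma>. finite_prefix s t} |s. s \<in> lists \<Sigma>}"
    then obtain s where "V = {t \<in> streams \<Sigma>. finite_prefix s t}" by blast
    \<comment> \<open>Whether a word lies in the cylinder of \<open>s\<close> depends only on its
      first \<open>length s\<close> letters.\<close>
    then have "openin (alexandroff_topology (streams \<Sigma>)
        (trace_le_k (trace_lts \<Sigma>) (length s))) V"
      by (auto simp: le_k finite_prefix_iff_stake)
    then show "openin (fin_trace_topology (trace_lts \<Sigma>)) V"
      unfolding fin_trace_topology_def by (intro openin_generated_topologyI) auto
  qed (simp add: fin_trace_topology_def openin_generated_topologyI)
  ultimately show ?thesis by (auto simp: topology_eq)
qed

lemma not_openin_cantor_topology_sconst:
  assumes "a \<in> \<Sigma>" "b \<in> \<Sigma>" "a \<noteq> b"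
  shows "\<not> openin (cantor_topology \<Sigma>) {sconst a}"
proof
  assume "openin (cantor_topology \<Sigma>) {sconst a}"
  then obtain k where
    k: "\<forall>u\<in>streams \<Sigma>. stake k u = stake k (sconst a) \<longrightarrow> u = sconst a"
    by (auto simp: openin_cantor_topology_iff)
  \<comment> \<open>This word agrees with \<open>sconst a\<close> on the positions below
    \<open>k\<close> and has \<open>b\<close> from position \<open>k\<close> on. It lies in the
    neighbourhood of depth \<open>k\<close>, yet differs from \<open>sconst a\<close> at position
    \<open>k\<close>.\<close>
  let ?u = "stake k (sconst a) @- sconst b"
  have "sconst a \<in> streams \<Sigma>" "sconst b \<in> streams \<Sigma>" using assms by (simp_all add: streams_iff_sset)
  then have "?u \<in> streams \<Sigma>" using stake_in_lists by (blast intro: shift_streams)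
  moreover have "stake k ?u = stake k (sconst a)" by (simp add: stake_shift)
  ultimately have "?u !! k = sconst a !! k" using k by metis
  with assms(3) show False by simp
qed

theorem corollary3p20:
  fixes \<Sigma> :: "'a set"
  assumes "finite \<Sigma>"
  shows "obs_topology (trace_lts \<Sigma>) = fin_trace_topology (trace_lts \<Sigma>)
       \<and> fin_trace_topology (trace_lts \<Sigma>) = cantor_topology \<Sigma>
       \<and> trace_topology (trace_lts \<Sigma>) = discrete_topology (streams \<Sigma>)
       \<and> (card \<Sigma> \<ge> 2 \<longrightarrow>
            obs_topology (trace_lts \<Sigma>) = fin_trace_topology (trace_lts \<Sigma>)
          \<and> {U. openin (fin_trace_topology (trace_lts \<Sigma>)) U}
              \<subset> {U. openin (trace_topology (trace_lts \<Sigma>)) U})"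
proof -
  have "{U. openin (cantor_topology \<Sigma>) U} \<subset> {U. openin (discrete_topology (streams \<Sigma>)) U}"
    if card: "card \<Sigma> \<ge> 2"
  proof -
    obtain a b where ab: "a \<in> \<Sigma>" "b \<in> \<Sigma>" "a \<noteq> b"
      using obtain_subset_with_card_n[OF card] by (metis card_2_iff insert_subset)
    \<comment> \<open>This singleton witnesses that the inclusion is strict.\<close>
    have "openin (discrete_topology (streams \<Sigma>)) {sconst a}"
      using ab by (simp add: streams_iff_sset)
    moreover have "openin (discrete_topology (streams \<Sigma>)) U" if "openin (cantor_topology \<Sigma>) U" for U
      using that by (simp add: openin_cantor_topology_iff)
    ultimately show ?thesis using not_openin_cantor_topology_sconst[OF ab] by blast
  qed
  then show ?thesis
    by (simp add: obs_topology_trace_lts fin_trace_topology_trace_lts trace_topology_trace_lts)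
qed

end
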